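(* Let $\mathcal{D}$ be the in-distribution (a probability distribution over trajectories on the time interval $[0,T]$) and let $\mathcal{D}_{\mathrm{calib}}=\{\tau_i\}_{i=1}^{N_{\mathrm{traj}}}$ be a held-out calibration dataset of trajectories from $\mathcal{D}$. For each $i$ let $$Q_i := \sup_{t\in[0,T]} D(X_{t,i}),$$ where $X_{t,i}$ is the embedding vector of trajectory $\tau_i$ at time $t$ and $D$ is the Jensen–Rényi divergence score of the trained ensemble. Let the threshold $D_{\mathrm{thr}}\in\mathbb{R}_{>0}$ be the $(1-\delta_{\mathrm{cal}})$-quantile of the calibration scores $\{Q_i\}_{i=1}^{N_{\mathrm{traj}}}$, defined as the $\lceil (1-\delta_{\mathrm{cal}})(N_{\mathrm{traj}}+1)\rceil$-th smallest value in the sorted list of calibration scores. Then for any test trajectory $\tau_{\mathrm{test}}$ drawn from the in-distribution $\mathcal{D}$, assuming exchangeability with the calibration trajectories in $\mathcal{D}_{\mathrm{calib}}$, the trajectory-level nonconformity score $$Q_{\mathrm{test}} := \sup_{t\in[0,T]} D(X_{t,\mathrm{test}})$$ satisfies $$\mathbb{P}\left(Q_{\mathrm{test}}\le D_{\mathrm{thr}}\right)\ \ge\ 1-\delta_{\mathrm{cal}}.$$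
   Context: Calibration data: the trajectories in $\mathcal{D}_{\mathrm{calib}}$ are assumed to be drawn i.i.d. from $\mathcal{D}$ (each is generated by independently sampling the initial robot state, the environment configuration and the candidate control-barrier-function parameter). They are not used to train the ensemble. The number $1-\delta_{\mathrm{cal}}$ is the chosen coverage level. Exchangeability means that the joint distribution of the calibration trajectories together with the test trajectory is invariant under permutation; the probability is over the draw of the calibration and test trajectories. Ensemble: $\mathbf{E}_1,\dots,\mathbf{E}_B$ are trained neural networks with weights $\boldsymbol\theta_1,\dots,\boldsymbol\theta_B$, each mapping an input vector $X$ to a Gaussian distribution $\mathcal{N}(\boldsymbol\mu_{\boldsymbol\theta_b}(X),\boldsymbol\Sigma_{\boldsymbol\theta_b}(X))$ with diagonal covariance. Score: $D(X)=D(X;\mathbf{E}_{1:B})\in\mathbb{R}$ is the Jensen–Rényi divergence $$D(X;\mathbf{E}_{1:B}) := H_2\Big(\sum_{b=1}^B \tfrac1B \mathbf{E}_b(X)\Big)-\sum_{b=1}^B \tfrac1B H_2(\mathbf{E}_b(X)),$$ where $\sum_b \frac1B \mathbf{E}_b(X)$ denotes the uniform mixture of the Gaussian distributions and $H_2$ is the quadratic Rényi entropy, $H_2(Z) := -\log\int p(z)^2\,dz$ for a random variable $Z$ with density $p$. Embedding: for a trajectory on $[0,T]$, the vector at time $t$ is $X_t=[\mathbf{c}^\top,\widetilde{\boldsymbol\alpha}^\top]^\top$, where $\mathbf{c}$ is a feature vector obtained by applying a trained graph-attention encoder to the robot, goal and obstacle information at time $t$, and $\widetilde{\boldsymbol\alpha}$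 is the candidate control-barrier-function parameter used for the trajectory. $X_{t,i}$ and $X_{t,\mathrm{test}}$ denote this vector for $\tau_i$ and $\tau_{\mathrm{test}}$, respectively. *)

theory Defs
  imports "HOL-Probability.Probability" "HOL-Combinatorics.Permutations"
begin

text \<open>
  A trajectory carries the robot, goal and obstacle information as functions of time, and the
  candidate control-barrier-function parameter. Only times in \<open>[0, T]\<close> are ever read.
\<close>

record ('r, 'g, 'o, 'p) trajectory =
  robot :: "real \<Rightarrow> 'r"
  goal :: "real \<Rightarrow> 'g"
  obstacles :: "real \<Rightarrow> 'o"
  cbf_param :: "real ^ 'p"

text \<open>The stacked vector \<open>[c, \<alpha>]\<close>, with coordinates indexed by the disjoint sum of index types.\<close>

definition embedding ::
  "('r \<times> 'g \<times> 'o \<Rightarrow> real ^ 'c) \<Rightarrow> ('r, 'g, 'o, 'p::finite) trajectory \<Rightarrow> real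
     \<Rightarrow> real ^ ('c::finite + 'p)" where
  "embedding enc \<tau> t =
     (\<chi> i. case i of
        Inl j \<Rightarrow> enc (robot \<tau> t, goal \<tau> t, obstacles \<tau> t) $ j
      | Inr j \<Rightarrow> cbf_param \<tau> $ j)"

definition gaussian_density ::
  "real ^ 'm \<Rightarrow> real ^ 'm ^ 'm \<Rightarrow> real ^ 'm::finite \<Rightarrow> real" where
  "gaussian_density \<mu> \<Sigma> z =
     exp (- ((z - \<mu>) \<bullet> (matrix_inv \<Sigma> *v (z - \<mu>))) / 2) / sqrt ((2 * pi) ^ CARD('m) * det \<Sigma>)"

text \<open>Distributions are represented by their Lebesgue densities in the next three definitions.\<close>

definition renyi_entropy2 :: "('z::euclidean_space \<Rightarrow> real) \<Rightarrow> real" where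
  "renyi_entropy2 p = - ln (LINT z|lborel. (p z)\<^sup>2)"

definition jensen_renyi_divergence ::
  "nat \<Rightarrow> (nat \<Rightarrow> 'z::euclidean_space \<Rightarrow> real) \<Rightarrow> real" where
  "jensen_renyi_divergence B p =
     renyi_entropy2 (\<lambda>z. \<Sum>b=1..B. 1 / real B * p b z) - (\<Sum>b=1..B. 1 / real B * renyi_entropy2 (p b))"

definition ensemble_divergence ::
  "('w \<Rightarrow> 'x \<Rightarrow> real ^ 'm) \<Rightarrow> ('w \<Rightarrow> 'x \<Rightarrow> real ^ 'm ^ 'm) \<Rightarrow> nat \<Rightarrow> (nat \<Rightarrow> 'w) \<Rightarrow> 'x
     \<Rightarrow> real" where
  "ensemble_divergence mean cov B \<theta> x =
     jensen_renyi_divergence B (\<lambda>b. gaussian_density (mean (\<theta> b) x) (cov (\<theta> b) x :: real ^ 'm::finite ^ 'm))"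

text \<open>Extended reals, so that the supremum is the true one even if the score is unbounded in time.\<close>

definition trajectory_score ::
  "real \<Rightarrow> ('x \<Rightarrow> real) \<Rightarrow> ('traj \<Rightarrow> real \<Rightarrow> 'x) \<Rightarrow> 'traj \<Rightarrow> ereal" where
  "trajectory_score T D X \<tau> = (SUP t\<in>{0..T}. ereal (D (X \<tau> t)))"

definition conformal_rank :: "real \<Rightarrow> nat \<Rightarrow> nat" where
  "conformal_rank \<delta> N = nat \<lceil>(1 - \<delta>) * (real N + 1)\<rceil>"

text \<open>
  The \<open>conformal_rank \<delta> N\<close>-th smallest among \<open>q 1, \<dots>, q N\<close>, counted with multiplicity;
  meaningful only if the rank lies in \<open>{1..N}\<close>.
\<close>

definition conformal_threshold :: "real \<Rightarrow> nat \<Rightarrow> (nat \<Rightarrow> 'a::linorder) \<Rightarrow> 'a" where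
  "conformal_threshold \<delta> N q = sort (map q [1..<Suc N]) ! (conformal_rank \<delta> N - 1)"

definition exchangeable ::
  "'\<omega> measure \<Rightarrow> 'a measure \<Rightarrow> 'i set \<Rightarrow> ('i \<Rightarrow> '\<omega> \<Rightarrow> 'a) \<Rightarrow> bool" where
  "exchangeable M S I Y \<longleftrightarrow>
     (\<forall>i\<in>I. Y i \<in> measurable M S) \<and>
     (\<forall>\<pi>. \<pi> permutes I \<longrightarrow>
        distr M (Pi\<^sub>M I (\<lambda>_. S)) (\<lambda>\<omega>. \<lambda>i\<in>I. Y (\<pi> i) \<omega>) =
        distr M (Pi\<^sub>M I (\<lambda>_. S)) (\<lambda>\<omega>. \<lambda>i\<in>I. Y i \<omega>))"

end

theory Submission
  imports Defs
begin

text \<open>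
  Call an index \<open>i\<close> of \<open>{1..N + 1}\<close> low if fewer than \<open>k\<close> of the \<open>N + 1\<close> scores lie strictly below
  the \<open>i\<close>-th one, where \<open>k\<close> is the conformal rank. At least \<open>k\<close> indices are low in every outcome, and
  by exchangeability all indices are low with the same probability, which is therefore at least
  \<open>k / (N + 1) \<ge> 1 - \<delta>\<close>. The test score does not exceed the \<open>k\<close>-th smallest calibration score exactly
  when the test index is low: the test score is not strictly below itself, so including it in the
  comparison is harmless. Strict comparison makes the argument indifferent to ties.
\<close>

lemma le_sort_nth_iff:
  fixes xs :: "'a::linorder list"
  assumes "n < length xs"
  shows "x \<le> sort xs ! n \<longleftrightarrow> length (filter (\<lambda>y. y < x) xs) \<le> n"
proof -
  let ?ys = "sort xs"
  \<comment> \<open>Since \<open>?ys\<close> is sorted, the positions in \<open>?J\<close> form an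
    initial segment. It avoids position \<open>n\<close> exactly when it has at most
    \<open>n\<close> elements, whatever the ties.\<close>
  let ?J = "{i. i < length ?ys \<and> ?ys ! i < x}"
  have "length (filter (\<lambda>y. y < x) xs) = length (filter (\<lambda>y. y < x) ?ys)"
    by (simp add: filter_sort)
  then have len: "length (filter (\<lambda>y. y < x) xs) = card ?J"
    by (simp add: length_filter_conv_card)
  show ?thesis
  proof (cases "x \<le> ?ys ! n")
    case True
    have "?J \<subseteq> {..<n}"
    proof
      fix i assume i: "i \<in> ?J"
      show "i \<in> {..<n}"
      proof (rule ccontr)
        assume "i \<notin> {..<n}"
        then have "?ys ! n \<le> ?ys ! i"
          using i by (intro sorted_nth_mono) auto
        with True i show False by auto
      qed
    qed
    then have "card ?J \<le> n"
      using card_mono[of "{..<n}" ?J] by simp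
    with True len show ?thesis by simp
  next
    case False
    have "{..n} \<subseteq> ?J"
    proof
      fix i assume "i \<in> {..n}"
      then have "?ys ! i \<le> ?ys ! n" "i < length ?ys"
        using assms by (auto intro: sorted_nth_mono)
      with False show "i \<in> ?J" by auto
    qed
    then have "card {..n} \<le> card ?J"
      by (intro card_mono) auto
    with False len show ?thesis by simp
  qed
qed

lemma le_conformal_threshold_iff:
  fixes q :: "nat \<Rightarrow> 'a::linorder"
  assumes "1 \<le> conformal_rank \<delta> N" "conformal_rank \<delta> N \<le> N"
  shows "x \<le> conformal_threshold \<delta> N q \<longleftrightarrow> card {j \<in> {1..N}. q j < x} < conformal_rank \<delta> N"
proof -
  have "length (filter (\<lambda>y. y < x) (map q [1..<Suc N])) = length (filter (\<lambda>j. q j < x) [1..<Suc N])"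
    by (simp add: filter_map comp_def del: upt_Suc)
  also have "\<dots> = card (set (filter (\<lambda>j. q j < x) [1..<Suc N]))"
    by (intro distinct_card[symmetric] distinct_filter distinct_upt)
  also have "set (filter (\<lambda>j. q j < x) [1..<Suc N]) = {j \<in> {1..N}. q j < x}"
    by auto
  finally show ?thesis
    \<comment> \<open>The list position is zero-based: a count of at most
      \<open>conformal_rank \<delta> N - 1\<close> is a count below the rank, as the rank is at
      least 1.\<close>
    unfolding conformal_threshold_def using assms by (subst le_sort_nth_iff) auto
qed

lemma conformal_rank_ge: "(1 - \<delta>) * (real N + 1) \<le> real (conformal_rank \<delta> N)"
  unfolding conformal_rank_def by linarith

text \<open>If some index fails the condition, take a failing one with least value. Every index
  strictly below it then satisfies the condition, and failure itself says that there are at least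
  \<open>k\<close> of those.\<close>

lemma card_low_rank_ge:
  fixes f :: "'i \<Rightarrow> 'a::linorder"
  assumes "finite I" "k \<le> card I"
  shows "k \<le> card {i \<in> I. card {j \<in> I. f j < f i} < k}"
proof (cases "{i \<in> I. card {j \<in> I. f j < f i} < k} = I")
  case True
  with assms show ?thesis by simp
next
  case False
  let ?H = "{i \<in> I. \<not> card {j \<in> I. f j < f i} < k}"
  have "finite ?H" "?H \<noteq> {}"
    using assms(1) False by auto
  then obtain i where i: "i \<in> ?H" and least: "\<And>j. j \<in> ?H \<Longrightarrow> f i \<le> f j"
    using arg_min_if_finite[of ?H f] by (metis (no_types, lifting) not_le_imp_less)
  then have "{j \<in> I. f j < f i} \<subseteq> {i \<in> I. card {j \<in> I. f j < f i} < k}"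
    by (fastforce simp: not_le[symmetric])
  then have "card {j \<in> I. f j < f i} \<le> card {i \<in> I. card {j \<in> I. f j < f i} < k}"
    using assms(1) by (intro card_mono) auto
  with i show ?thesis by auto
qed

text \<open>The count is a finite sum of indicators of comparison events, which are measurable in a
  second countable order topology.\<close>

lemma sets_Collect_low_rank:
  fixes g :: "'i \<Rightarrow> 'w \<Rightarrow> 'b::{second_countable_topology, linorder_topology}"
  assumes "finite I" "i \<in> I" "\<And>j. j \<in> I \<Longrightarrow> g j \<in> borel_measurable M"
  shows "{\<omega> \<in> space M. card {j \<in> I. g j \<omega> < g i \<omega>} < k} \<in> sets M"
proof -
  have "(\<lambda>\<omega>. \<Sum>j\<in>I. if g j \<omega> < g i \<omega> then 1 else 0 :: real) \<in> borel_measurable M"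
    using assms by (intro borel_measurable_sum measurable_If borel_measurable_less) auto
  then have "{\<omega> \<in> space M. (\<Sum>j\<in>I. if g j \<omega> < g i \<omega> then 1 else 0 :: real) < real k} \<in> sets M"
    by measurable
  moreover have "(\<Sum>j\<in>I. if g j \<omega> < g i \<omega> then 1 else 0 :: real) = real (card {j \<in> I. g j \<omega> < g i \<omega>})" for \<omega>
    using assms(1) by (simp add: sum.If_cases Int_def)
  ultimately show ?thesis by simp
qed

text \<open>Swapping \<open>i\<close> and \<open>l\<close> preserves the joint law, and the number
  of scores below a given value does not depend on their order.\<close>

lemma exchangeable_low_rank_prob_eq:
  fixes f :: "'a \<Rightarrow> 'b::{second_countable_topology, linorder_topology}"
  assumes exch: "exchangeable M S I Y" and I: "finite I" "i \<in> I" "l \<in> I"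
    and f: "f \<in> borel_measurable S"
  shows "measure M {\<omega> \<in> space M. card {j \<in> I. f (Y j \<omega>) < f (Y i \<omega>)} < k} =
    measure M {\<omega> \<in> space M. card {j \<in> I. f (Y j \<omega>) < f (Y l \<omega>)} < k}"
proof -
  let ?\<pi> = "Transposition.transpose i l"
  let ?P = "Pi\<^sub>M I (\<lambda>_. S)"
  \<comment> \<open>The event for \<open>l\<close> is stated on the product space, so that its
    probability depends on the joint law alone.\<close>
  let ?E = "{v \<in> space ?P. card {j \<in> I. f (v j) < f (v l)} < k}"
  have perm: "?\<pi> permutes I"
    using I by (simp add: permutes_swap_id)
  have Y: "Y j \<in> measurable M S" if "j \<in> I" for j
    using exch that by (auto simp: exchangeable_def)
  have E: "?E \<in> sets ?P"
    using I f by (intro sets_Collect_low_rank measurable_compose[OF measurable_component_singleton]) auto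
  have vec: "(\<lambda>\<omega>. \<lambda>j\<in>I. Y (\<sigma> j) \<omega>) \<in> measurable M ?P" if "\<sigma> permutes I" for \<sigma>
    using that by (intro measurable_restrict Y) (auto simp: permutes_in_image)
  have pull: "measure (distr M ?P (\<lambda>\<omega>. \<lambda>j\<in>I. Y (\<sigma> j) \<omega>)) ?E =
      measure M {\<omega> \<in> space M. card {j \<in> I. f (Y j \<omega>) < f (Y (\<sigma> l) \<omega>)} < k}"
    if \<sigma>: "\<sigma> permutes I" for \<sigma>
  proof -
    \<comment> \<open>Reindexing by \<open>\<sigma>\<close> leaves the count unchanged; only the
      reference index moves, from \<open>l\<close> to \<open>\<sigma> l\<close>.\<close>
    have "card {j \<in> I. f ((\<lambda>j\<in>I. Y (\<sigma> j) \<omega>) j) < f ((\<lambda>j\<in>I. Y (\<sigma> j) \<omega>) l)} =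
        card {j \<in> I. f (Y j \<omega>) < f (Y (\<sigma> l) \<omega>)}" for \<omega>
    proof (rule bij_betw_same_card)
      show "bij_betw \<sigma> {j \<in> I. f ((\<lambda>j\<in>I. Y (\<sigma> j) \<omega>) j) < f ((\<lambda>j\<in>I. Y (\<sigma> j) \<omega>) l)}
          {j \<in> I. f (Y j \<omega>) < f (Y (\<sigma> l) \<omega>)}"
        using I(3) by (intro bij_betw_Collect permutes_imp_bij[OF \<sigma>]) auto
    qed
    then have "(\<lambda>\<omega>. \<lambda>j\<in>I. Y (\<sigma> j) \<omega>) -` ?E \<inter> space M =
        {\<omega> \<in> space M. card {j \<in> I. f (Y j \<omega>) < f (Y (\<sigma> l) \<omega>)} < k}"
      using measurable_space[OF vec[OF \<sigma>]] by auto
    then show ?thesis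
      using measure_distr[OF vec[OF \<sigma>] E] by simp
  qed
  \<comment> \<open>The unpermuted family is written with \<open>id\<close>, so that
    \<open>pull\<close> applies to both sides; \<open>?\<pi>\<close> sends \<open>l\<close> to
    \<open>i\<close>.\<close>
  have "distr M ?P (\<lambda>\<omega>. \<lambda>j\<in>I. Y (?\<pi> j) \<omega>) = distr M ?P (\<lambda>\<omega>. \<lambda>j\<in>I. Y (id j) \<omega>)"
    using exch perm by (simp add: exchangeable_def)
  then show ?thesis
    using pull[OF perm] pull[OF permutes_id] by simp
qed

text \<open>The expected number of low indices is computed in two ways: it is at least
  \<open>k\<close> because the number is so in every outcome, and by linearity it is a sum of
  \<open>card I\<close> equal probabilities.\<close>

lemma (in prob_space) exchangeable_low_rank_prob_ge:
  fixes f :: "'b \<Rightarrow> 'c::{second_countable_topology, linorder_topology}"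
  assumes exch: "exchangeable M S I Y" and I: "finite I" "l \<in> I"
    and f: "f \<in> borel_measurable S" and k: "k \<le> card I"
  shows "real k \<le> real (card I) * prob {\<omega> \<in> space M. card {j \<in> I. f (Y j \<omega>) < f (Y l \<omega>)} < k}"
proof -
  let ?A = "\<lambda>i. {\<omega> \<in> space M. card {j \<in> I. f (Y j \<omega>) < f (Y i \<omega>)} < k}"
  have A: "?A i \<in> events" if "i \<in> I" for i
    using exch I(1) that f
    by (intro sets_Collect_low_rank measurable_compose[OF _ f]) (auto simp: exchangeable_def)
  have int: "integrable M (\<lambda>\<omega>. indicat_real (?A i) \<omega>)" if "i \<in> I" for i
    using A[OF that] by (simp add: integrable_indicator_iff less_top[symmetric])
  have ge: "real k \<le> (\<Sum>i\<in>I. indicat_real (?A i) \<omega>)" if "\<omega> \<in> space M" for \<omega>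
  proof -
    have "(\<Sum>i\<in>I. indicat_real (?A i) \<omega>) = real (card {i \<in> I. card {j \<in> I. f (Y j \<omega>) < f (Y i \<omega>)} < k})"
      using I(1) that by (simp add: indicator_def sum.If_cases Int_def)
    then show ?thesis
      using card_low_rank_ge[OF I(1) k, of "\<lambda>i. f (Y i \<omega>)"] by simp
  qed
  have "real k = (\<integral>\<omega>. real k \<partial>M)"
    by (simp add: prob_space)
  also have "\<dots> \<le> (\<integral>\<omega>. (\<Sum>i\<in>I. indicat_real (?A i) \<omega>) \<partial>M)"
    using int ge by (intro integral_mono Bochner_Integration.integrable_sum) auto
  also have "\<dots> = (\<Sum>i\<in>I. \<integral>\<omega>. indicat_real (?A i) \<omega> \<partial>M)"
    using int by (intro Bochner_Integration.integral_sum) auto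
  also have "\<dots> = (\<Sum>i\<in>I. prob (?A i))"
    by (intro sum.cong refl) (auto intro: arg_cong[where f = prob])
  also have "\<dots> = (\<Sum>i\<in>I. prob (?A l))"
    using exchangeable_low_rank_prob_eq[OF exch I(1) _ I(2) f] by (intro sum.cong refl) auto
  finally show ?thesis by simp
qed

theorem theorem2:
  fixes M :: "'\<omega> measure"
    and \<D> :: "('r, 'g, 'o, 'p::finite) trajectory measure"
    and \<tau> :: "nat \<Rightarrow> '\<omega> \<Rightarrow> ('r, 'g, 'o, 'p) trajectory"
    and \<tau>test :: "'\<omega> \<Rightarrow> ('r, 'g, 'o, 'p) trajectory"
    and N B :: nat
    and T \<delta> :: real
    and enc :: "'r \<times> 'g \<times> 'o \<Rightarrow> real ^ 'c::finite"
    and \<theta> :: "nat \<Rightarrow> 'w"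
    and mean :: "'w \<Rightarrow> real ^ ('c + 'p) \<Rightarrow> real ^ 'm::finite"
    and cov :: "'w \<Rightarrow> real ^ ('c + 'p) \<Rightarrow> real ^ 'm ^ 'm"
    and Q :: "('r, 'g, 'o, 'p) trajectory \<Rightarrow> ereal"
    and Dthr :: "'\<omega> \<Rightarrow> ereal"
  assumes prob_M: "prob_space M"
    and prob_D: "prob_space \<D>"
    and T: "0 \<le> T"
    and \<delta>: "0 < \<delta>" "\<delta> < 1"
    and B: "1 \<le> B"
    and cov_diag: "\<And>b x i j. b \<in> {1..B} \<Longrightarrow> i \<noteq> j \<Longrightarrow> cov (\<theta> b) x $ i $ j = 0"
    and cov_pos: "\<And>b x i. b \<in> {1..B} \<Longrightarrow> cov (\<theta> b) x $ i $ i > 0"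
    and Q_def: "Q = trajectory_score T (ensemble_divergence mean cov B \<theta>) (embedding enc)"
    and Q_meas: "Q \<in> borel_measurable \<D>"
    and calib_indep: "prob_space.indep_vars M (\<lambda>_. \<D>) \<tau> {1..N}"
    and calib_distr: "\<And>i. i \<in> {1..N} \<Longrightarrow> distr M \<D> (\<tau> i) = \<D>"
    and test_meas: "\<tau>test \<in> measurable M \<D>"
    and test_distr: "distr M \<D> \<tau>test = \<D>"
    and exch: "exchangeable M \<D> {1..Suc N} (\<tau>(Suc N := \<tau>test))"
    and rank: "conformal_rank \<delta> N \<le> N"
    and Dthr_def: "\<And>\<omega>. Dthr \<omega> = conformal_threshold \<delta> N (\<lambda>i. Q (\<tau> i \<omega>))"
    and Dthr_pos_real: "AE \<omega> in M. 0 < Dthr \<omega> \<and> Dthr \<omega> < \<infinity>"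
  shows "\<P>(\<omega> in M. Q (\<tau>test \<omega>) \<le> Dthr \<omega>) \<ge> 1 - \<delta>"
proof -
  interpret prob_space M by (rule prob_M)
  let ?k = "conformal_rank \<delta> N"
  let ?Y = "\<tau>(Suc N := \<tau>test)"
  let ?I = "{1..Suc N}"
  let ?A = "{\<omega> \<in> space M. card {j \<in> ?I. Q (?Y j \<omega>) < Q (?Y (Suc N) \<omega>)} < ?k}"
  \<comment> \<open>A positive rank guarantees that the subtraction of 1 in
    \<open>conformal_threshold\<close> is not truncated at zero.\<close>
  have "0 < (1 - \<delta>) * (real N + 1)"
    using \<delta> by (intro mult_pos_pos) auto
  then have k1: "1 \<le> ?k"
    using conformal_rank_ge[of \<delta> N] by linarith
  have "{j \<in> ?I. Q (?Y j \<omega>) < Q (?Y (Suc N) \<omega>)} = {j \<in> {1..N}. Q (\<tau> j \<omega>) < Q (\<tau>test \<omega>)}" for \<omega>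
    by (auto simp: le_Suc_eq)
  then have event: "{\<omega> \<in> space M. Q (\<tau>test \<omega>) \<le> Dthr \<omega>} = ?A"
    by (simp add: Dthr_def le_conformal_threshold_iff[OF k1 rank])
  \<comment> \<open>The ceiling rounds the rank up, which is the safe direction. The factor
    \<open>real N + 1\<close> is the size of \<open>?I\<close> and cancels at the end.\<close>
  have "(1 - \<delta>) * (real N + 1) \<le> real ?k"
    by (rule conformal_rank_ge)
  also have "\<dots> \<le> real (card ?I) * prob ?A"
    using rank by (intro exchangeable_low_rank_prob_ge[OF exch _ _ Q_meas]) auto
  also have "\<dots> = prob ?A * (real N + 1)"
    by simp
  finally have "1 - \<delta> \<le> prob ?A"
    by (rule mult_right_le_imp_le) simp
  then show ?thesis
    by (simp only: event)
qed

end
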